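(* Let $k\ge 1$ and let $G$ be a finite simple connected graph of order $n(G)$. Then $\mathrm{f}\mu^{k}(G)=n(G)-k-1$ if and only if $G\in\mathcal{H}_{n(G),k}$.
   Context: For an integer $k\ge 0$ and a connected graph $G$, a set $X\subseteq V(G)$ is a $k$-fault-tolerant mutual-visibility set ($k$-ftmv set) if for any two non-adjacent vertices $u,v\in X$ there exist $k+1$ internally vertex-disjoint shortest $u,v$-paths $Q_1,\dots,Q_{k+1}$ in $G$ such that $V(Q_i)\cap X=\{u,v\}$ for every $i$. $\mathrm{f}\mu^{k}(G)$ denotes the maximum cardinality of a $k$-ftmv set of $G$. For $k\ge 1$ and $n\ge k+2$, the family $\mathcal{H}_{n,k}$ consists of all graphs $\widehat{H}$ obtained as follows: take an arbitrary graph $H$ of order $n-k-1$; let $A$ be the (possibly empty) set of universal vertices of $H$ (vertices adjacent to all other vertices of $H$) and $B=V(H)\setminus A$; add a set $W$ of $k+1$ new vertices and all edges between $W$ and $B$; finally add some arbitrary edges among the vertices of $W$ and some arbitrary edges between $W$ and $A$, such that the resulting graph $\widehat{H}$ (of order $n$) is connected and has clique number $\omega(\widehat{H})\le n-k-1$. *)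

theory Defs
  imports "Graph_Theory.Graph_Theory"
begin

text \<open>
  A finite simple graph is a \<open>pair_graph\<close>: a finite, loop-free, symmetric digraph without
  parallel arcs. An undirected edge uv is the pair of arcs (u, v) and (v, u); the library
  also admits the graph without vertices, but its \<open>connected\<close> excludes it.
\<close>

definition shortest_path :: "'a pair_pre_digraph \<Rightarrow> 'a \<Rightarrow> 'a list \<Rightarrow> 'a \<Rightarrow> bool" where
  "shortest_path G u p v \<longleftrightarrow>
     vpath p (with_proj G) \<and> hd p = u \<and> last p = v \<and>
     (\<forall>q. vpath q (with_proj G) \<and> hd q = u \<and> last q = v \<longrightarrow> vwalk_length p \<le> vwalk_length q)"

definition internally_disjoint :: "'a \<Rightarrow> 'a \<Rightarrow> 'a list \<Rightarrow> 'a list \<Rightarrow> bool" where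
  "internally_disjoint u v p q \<longleftrightarrow> (set p - {u, v}) \<inter> (set q - {u, v}) = {}"

text \<open>\<open>card P = k + 1\<close> makes the k + 1 paths in P pairwise different.\<close>

definition ftmv_set :: "nat \<Rightarrow> 'a pair_pre_digraph \<Rightarrow> 'a set \<Rightarrow> bool" where
  "ftmv_set k G X \<longleftrightarrow>
     X \<subseteq> pverts G \<and>
     (\<forall>u\<in>X. \<forall>v\<in>X. u \<noteq> v \<and> (u, v) \<notin> parcs G \<longrightarrow>
        (\<exists>P. card P = k + 1 \<and>
             (\<forall>p\<in>P. shortest_path G u p v \<and> set p \<inter> X = {u, v}) \<and>
             pairwise (internally_disjoint u v) P))"

definition ftmv_number :: "nat \<Rightarrow> 'a pair_pre_digraph \<Rightarrow> nat" where
  "ftmv_number k G = Max {card X | X. ftmv_set k G X}"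

definition clique :: "'a pair_pre_digraph \<Rightarrow> 'a set \<Rightarrow> bool" where
  "clique G C \<longleftrightarrow> C \<subseteq> pverts G \<and> (\<forall>u\<in>C. \<forall>v\<in>C. u \<noteq> v \<longrightarrow> (u, v) \<in> parcs G)"

definition clique_number :: "'a pair_pre_digraph \<Rightarrow> nat" where
  "clique_number G = Max {card C | C. clique G C}"

definition universal_verts :: "'a pair_pre_digraph \<Rightarrow> 'a set" where
  "universal_verts H = {a \<in> pverts H. \<forall>x\<in>pverts H. x \<noteq> a \<longrightarrow> (a, x) \<in> parcs H}"

text \<open>
  \<open>hat_graph H W EW EA\<close> adds the new vertices W to H, joins them to all non-universal vertices
  of H, and adds the further edges EW inside W (both orientations of each edge) and EA from W
  to the universal vertices (one orientation, the other is supplied here).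
\<close>

definition hat_graph ::
  "'a pair_pre_digraph \<Rightarrow> 'a set \<Rightarrow> ('a \<times> 'a) set \<Rightarrow> ('a \<times> 'a) set \<Rightarrow> 'a pair_pre_digraph" where
  "hat_graph H W EW EA =
     (let B = pverts H - universal_verts H in
      \<lparr> pverts = pverts H \<union> W,
        parcs = parcs H \<union> (W \<times> B \<union> B \<times> W) \<union> EW \<union> (EA \<union> EA\<inverse>) \<rparr>)"

text \<open>
  Vertices of H and W are taken from the same type as those of the resulting graph, so the
  family is closed under renaming vertices within that type.
\<close>

definition H_family :: "nat \<Rightarrow> nat \<Rightarrow> 'a pair_pre_digraph set" where
  "H_family n k =
     {G. 1 \<le> k \<and> k + 2 \<le> n \<and>
         (\<exists>H W EW EA.
            pair_graph H \<and> card (pverts H) = n - k - 1 \<and>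
            finite W \<and> card W = k + 1 \<and> W \<inter> pverts H = {} \<and>
            EW \<subseteq> W \<times> W \<and> sym EW \<and> irrefl EW \<and>
            EA \<subseteq> W \<times> universal_verts H \<and>
            G = hat_graph H W EW EA) \<and>
         Digraph_Component.connected (with_proj G) \<and>
         clique_number G \<le> n - k - 1}"

end

theory Submission
  imports Defs
begin

text \<open>
  Two non-adjacent vertices of a \<open>k\<close>-ftmv set \<open>X\<close> are joined by \<open>k + 1\<close> paths whose interiors are
  non-empty, pairwise disjoint and contained in the complement of \<open>X\<close>. Hence \<open>X\<close> is a clique or
  misses at least \<open>k + 1\<close> vertices, and if it misses exactly \<open>k + 1\<close>, then every interior is a
  single vertex, so each vertex outside \<open>X\<close> is adjacent to each vertex that is not universal in the
  graph induced by \<open>X\<close>: the graph is a hat graph over that induced subgraph. Conversely, in a hat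
  graph over \<open>H\<close> the paths of length 2 through \<open>W\<close> show that the vertices of \<open>H\<close> form a \<open>k\<close>-ftmv set,
  and the bound on the clique number excludes larger ones.
\<close>

section \<open>Paths between non-adjacent vertices\<close>

lemma vpath_nonadjacent:
  assumes "vpath p (with_proj G)" "u \<noteq> v" "(u, v) \<notin> parcs G" "hd p = u" "last p = v"
  obtains x y z r where "p = x # y # z # r"
\<comment> \<open>The rule separates lists of length 0 and 1 from longer ones; the inner case split
  excludes length 2, where \<open>(u, v)\<close> would be an arc.\<close>
proof (cases p rule: vwalk_arcs.cases)
  case (3 x y xs)
  with assms show ?thesis
    by (cases xs) (auto simp: vpath_def vwalk_def intro: that)
qed (use assms in \<open>auto simp: vpath_def vwalk_def\<close>)

text \<open>The second vertex is interior: vertices of a path are distinct, and it is neither first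
  nor last.\<close>

lemma vpath_interior_nonempty:
  assumes "vpath p (with_proj G)" "u \<noteq> v" "(u, v) \<notin> parcs G" "hd p = u" "last p = v"
  shows "set p - {u, v} \<noteq> {}"
proof -
  obtain x y z r where p: "p = x # y # z # r"
    using vpath_nonadjacent[OF assms] .
  have "last (z # r) \<in> set (z # r)"
    by (rule last_in_set) simp
  then have "y \<noteq> u" "y \<noteq> v"
    using assms p by (auto simp: vpath_def simp del: last.simps)
  then show ?thesis
    using p by auto
qed

text \<open>Distinct vertices drawn from \<open>{u, v, w}\<close> leave room for only three, so the
  path is \<open>[u, w, v]\<close>.\<close>

lemma vpath_single_interior:
  assumes "vpath p (with_proj G)" "u \<noteq> v" "(u, v) \<notin> parcs G" "hd p = u" "last p = v"
    and "set p - {u, v} = {w}"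
  shows "(u, w) \<in> parcs G" "(w, v) \<in> parcs G"
proof -
  obtain x y z r where p: "p = x # y # z # r"
    using vpath_nonadjacent[OF assms(1-5)] .
  have "length p = card (set p)"
    using assms(1) by (auto simp: vpath_def distinct_card)
  also have "\<dots> \<le> card {u, v, w}"
    using assms(6) by (intro card_mono) auto
  also have "\<dots> \<le> 3"
    by (simp add: card_insert_if)
  finally have "r = []"
    using p by simp
  then have "p = [u, w, v]"
    using p assms by (auto simp: vpath_def)
  then show "(u, w) \<in> parcs G" "(w, v) \<in> parcs G"
    using assms(1) by (auto simp: vpath_def vwalk_def)
qed

lemma shortest_path_common_neighbour:
  assumes "pair_graph G" "u \<noteq> v" "(u, v) \<notin> parcs G" "(u, w) \<in> parcs G" "(w, v) \<in> parcs G"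
  shows "shortest_path G u [u, w, v] v"
proof -
  interpret pair_graph G by fact
  have "vpath [u, w, v] (with_proj G)"
    using assms no_loops' by (auto simp: vpath_def vwalk_def dest: wellformed')
  moreover have "vwalk_length [u, w, v] \<le> vwalk_length q"
    if "vpath q (with_proj G)" "hd q = u" "last q = v" for q
    using vpath_nonadjacent[OF that(1) assms(2,3) that(2,3)] by fastforce
  ultimately show ?thesis
    unfolding shortest_path_def by simp
qed

section \<open>Vertices outside a fault-tolerant mutual-visibility set\<close>

lemma ftmv_set_nonadjacent:
  assumes "pair_graph G" "ftmv_set k G X" "u \<in> X" "v \<in> X" "u \<noteq> v" "(u, v) \<notin> parcs G"
  shows "k + 1 \<le> card (pverts G - X)"
    and "card (pverts G - X) = k + 1 \<Longrightarrow> w \<in> pverts G - X \<Longrightarrow>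
      (u, w) \<in> parcs G \<and> (w, v) \<in> parcs G"
proof -
  interpret pair_graph G by fact
  obtain P where P: "card P = k + 1"
      "\<And>p. p \<in> P \<Longrightarrow> shortest_path G u p v \<and> set p \<inter> X = {u, v}"
      "pairwise (internally_disjoint u v) P"
    using assms unfolding ftmv_set_def by meson
  define I where "I p = set p - {u, v}" for p
  have path: "vpath p (with_proj G)" "hd p = u" "last p = v" if "p \<in> P" for p
    using P(2)[OF that] by (auto simp: shortest_path_def)
  have sub: "I p \<subseteq> pverts G - X" if "p \<in> P" for p
    using P(2)[OF that] path[OF that] by (auto simp: I_def vpath_def vwalk_def)
  have "\<exists>x. x \<in> I p" if "p \<in> P" for p
    using vpath_interior_nonempty[OF path(1)[OF that] assms(5,6) path(2,3)[OF that]]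
    by (auto simp: I_def)
  \<comment> \<open>\<open>f\<close> selects one interior vertex per path; disjointness of the
    interiors makes it injective, which gives the lower bound on the complement.\<close>
  then obtain f where f: "\<And>p. p \<in> P \<Longrightarrow> f p \<in> I p"
    by metis
  have disj: "p = q" if "p \<in> P" "q \<in> P" "x \<in> I p" "x \<in> I q" for p q x
    using that P(3) by (auto simp: pairwise_def internally_disjoint_def I_def)
  have "inj_on f P"
    using disj f by (metis inj_onI)
  then have card_f: "card (f ` P) = k + 1"
    using P(1) by (simp add: card_image)
  have f_sub: "f ` P \<subseteq> pverts G - X"
    using f sub by blast
  have fin: "finite (pverts G - X)"
    using pair_finite_verts by simp
  show "k + 1 \<le> card (pverts G - X)"
    using card_mono[OF fin f_sub] card_f by simp
  show "(u, w) \<in> parcs G \<and> (w, v) \<in> parcs G"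
    if "card (pverts G - X) = k + 1" and w: "w \<in> pverts G - X"
  proof -
    have onto: "f ` P = pverts G - X"
      using card_subset_eq[OF fin f_sub] card_f that by simp
    then obtain p where p: "p \<in> P" "w = f p"
      using w by auto
    have "I p = {w}"
    proof
      \<comment> \<open>Since \<open>f\<close> is onto the complement, any interior vertex
        \<open>x\<close> of \<open>p\<close> is the one selected from some \<open>q\<close>;
        disjointness forces \<open>q = p\<close>, hence \<open>x = w\<close>.\<close>
      show "I p \<subseteq> {w}"
      proof
        fix x assume x: "x \<in> I p"
        then obtain q where "q \<in> P" "x = f q"
          using sub[OF p(1)] onto by blast
        then show "x \<in> {w}"
          using disj[of p q x] x f p by auto
      qed
    qed (use f p in auto)
    then show ?thesis
      using vpath_single_interior[OF path(1)[OF p(1)] assms(5,6) path(2,3)[OF p(1)]]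
      by (simp add: I_def)
  qed
qed

text \<open>The path condition is vacuous without non-adjacent pairs.\<close>

lemma ftmv_set_clique: "clique G C \<Longrightarrow> ftmv_set k G C"
  by (auto simp: clique_def ftmv_set_def)

lemma card_ftmv_set_le:
  assumes "pair_graph G" "ftmv_set k G X"
  shows "clique G X \<or> card X + k + 1 \<le> card (pverts G)"
proof (rule disjCI)
  interpret pair_graph G by fact
  assume "\<not> card X + k + 1 \<le> card (pverts G)"
  moreover have X: "X \<subseteq> pverts G"
    using assms by (simp add: ftmv_set_def)
  then have "card (pverts G - X) = card (pverts G) - card X"
    by (meson card_Diff_subset finite_subset pair_finite_verts)
  ultimately have "\<not> k + 1 \<le> card (pverts G - X)"
    by linarith
  then show "clique G X"
    using ftmv_set_nonadjacent(1)[OF assms] X unfolding clique_def by blast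
qed

section \<open>The two maxima: finiteness and attainment\<close>

lemma finite_card_subsets:
  assumes "finite V" "\<And>X. P X \<Longrightarrow> X \<subseteq> V"
  shows "finite {card X | X. P X}"
  by (rule finite_subset[of _ "card ` Pow V"]) (use assms in auto)

lemma ftmv_number_ge:
  assumes "pair_graph G" "ftmv_set k G X"
  shows "card X \<le> ftmv_number k G"
proof -
  interpret pair_graph G by fact
  have "finite {card X | X. ftmv_set k G X}"
    by (rule finite_card_subsets[OF pair_finite_verts]) (simp add: ftmv_set_def)
  then show ?thesis
    unfolding ftmv_number_def using assms(2) by (intro Max_ge) auto
qed

lemma ftmv_number_attained:
  assumes "pair_graph G"
  obtains X where "ftmv_set k G X" "card X = ftmv_number k G"
proof -
  interpret pair_graph G by fact
  have "finite {card X | X. ftmv_set k G X}"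
    by (rule finite_card_subsets[OF pair_finite_verts]) (simp add: ftmv_set_def)
  \<comment> \<open>\<open>Max_in\<close> needs a non-empty collection; the empty set is a
    member.\<close>
  moreover have "ftmv_set k G {}"
    by (simp add: ftmv_set_def)
  ultimately have "ftmv_number k G \<in> {card X | X. ftmv_set k G X}"
    unfolding ftmv_number_def by (intro Max_in) auto
  then show ?thesis
    using that by auto
qed

lemma clique_number_ge:
  assumes "pair_graph G" "clique G C"
  shows "card C \<le> clique_number G"
proof -
  interpret pair_graph G by fact
  have "finite {card C | C. clique G C}"
    by (rule finite_card_subsets[OF pair_finite_verts]) (simp add: clique_def)
  then show ?thesis
    unfolding clique_number_def using assms(2) by (intro Max_ge) auto
qed

text \<open>This yields the clique bound required for membership in \<open>H_family\<close>.\<close>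

lemma clique_number_le_ftmv_number:
  assumes "pair_graph G"
  shows "clique_number G \<le> ftmv_number k G"
proof -
  interpret pair_graph G by fact
  have "finite {card C | C. clique G C}"
    by (rule finite_card_subsets[OF pair_finite_verts]) (simp add: clique_def)
  moreover have "clique G {}"
    by (simp add: clique_def)
  ultimately have "clique_number G \<in> {card C | C. clique G C}"
    unfolding clique_number_def by (intro Max_in) auto
  then show ?thesis
    using ftmv_number_ge[OF assms ftmv_set_clique] by auto
qed

section \<open>From extremal sets to hat graphs\<close>

lemma pair_graph_induced:
  assumes "pair_graph G" "X \<subseteq> pverts G"
  shows "pair_graph \<lparr> pverts = X, parcs = parcs G \<inter> X \<times> X \<rparr>"
proof -
  interpret pair_graph G by fact
  show ?thesis
  proof unfold_locales
    show "symmetric (with_proj \<lparr> pverts = X, parcs = parcs G \<inter> X \<times> X \<rparr>)"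
      using arcs_symmetric by (auto simp: symmetric_def intro: symI)
  qed (use assms(2) pair_finite_verts pair_finite_arcs pair_no_loops in
      \<open>auto intro: finite_subset\<close>)
qed

text \<open>A vertex of \<open>X\<close> that is not universal in \<open>H\<close> has a
  non-neighbour in \<open>X\<close>, so \<open>adj\<close> joins it to all of \<open>W\<close>. The
  remaining arcs at \<open>W\<close> stay inside \<open>W\<close> or meet universal vertices, and
  are recovered by intersecting with \<open>parcs G\<close>.\<close>

lemma hat_graph_induced:
  fixes G :: "'a pair_pre_digraph"
  assumes "pair_graph G" "X \<subseteq> pverts G"
    and adj: "\<And>u v w. u \<in> X \<Longrightarrow> v \<in> X \<Longrightarrow> u \<noteq> v \<Longrightarrow> (u, v) \<notin> parcs G \<Longrightarrow>
      w \<in> pverts G - X \<Longrightarrow> (u, w) \<in> parcs G"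
  defines "H \<equiv> \<lparr> pverts = X, parcs = parcs G \<inter> X \<times> X \<rparr>"
    and "W \<equiv> pverts G - X"
  shows "G = hat_graph H W (parcs G \<inter> W \<times> W) (parcs G \<inter> W \<times> universal_verts H)"
proof -
  interpret pair_graph G by fact
  let ?A = "universal_verts H"
  let ?B = "X - ?A"
  have BW: "(b, w) \<in> parcs G" "(w, b) \<in> parcs G" if "b \<in> ?B" "w \<in> W" for b w
  proof -
    obtain x where "x \<in> X" "x \<noteq> b" "(b, x) \<notin> parcs G"
      using \<open>b \<in> ?B\<close> by (auto simp: universal_verts_def H_def)
    then show "(b, w) \<in> parcs G"
      using adj[of b x w] that by (auto simp: W_def)
    then show "(w, b) \<in> parcs G"
      by (rule arcs_symmetric)
  qed
  have A: "?A \<subseteq> X"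
    by (auto simp: universal_verts_def H_def)
  have "parcs G = parcs H \<union> (W \<times> ?B \<union> ?B \<times> W) \<union> parcs G \<inter> W \<times> W
      \<union> (parcs G \<inter> W \<times> ?A \<union> (parcs G \<inter> W \<times> ?A)\<inverse>)" (is "_ = ?R")
  proof
    show "parcs G \<subseteq> ?R"
      using wellformed' arcs_symmetric by (auto simp: H_def W_def)
    show "?R \<subseteq> parcs G"
      using BW arcs_symmetric by (auto simp: H_def)
  qed
  moreover have "pverts G = X \<union> W"
    using assms(2) by (auto simp: W_def)
  ultimately show ?thesis
    by (cases G) (auto simp: hat_graph_def H_def)
qed

lemma H_familyI:
  fixes G :: "'a pair_pre_digraph"
  assumes "k \<ge> 1" "pair_graph G" "Digraph_Component.connected (with_proj G)"
    and "ftmv_number k G + k + 1 = card (pverts G)"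
  shows "G \<in> H_family (card (pverts G)) k"
proof -
  interpret pair_graph G by fact
  obtain X where X: "ftmv_set k G X" "card X = ftmv_number k G"
    using ftmv_number_attained[OF assms(2)] .
  have XV: "X \<subseteq> pverts G"
    using X(1) by (simp add: ftmv_set_def)
  have "pverts G \<noteq> {}"
    using assms(3) by (auto simp: connected_def strongly_connected_def)
  then obtain a where "a \<in> pverts G"
    by auto
  \<comment> \<open>A singleton satisfies the definition vacuously; this bound later gives
    \<open>k + 2 \<le> card (pverts G)\<close>.\<close>
  then have pos: "1 \<le> ftmv_number k G"
    using ftmv_number_ge[OF assms(2), of k "{a}"] by (auto simp: ftmv_set_def)
  define H where "H = \<lparr> pverts = X, parcs = parcs G \<inter> X \<times> X \<rparr>"
  define W where "W = pverts G - X"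
  have cW: "card W = k + 1"
    using card_Diff_subset[OF finite_subset[OF XV pair_finite_verts] XV] X assms(4)
    by (simp add: W_def)
  have "(u, w) \<in> parcs G"
    if "u \<in> X" "v \<in> X" "u \<noteq> v" "(u, v) \<notin> parcs G" "w \<in> pverts G - X" for u v w
    using ftmv_set_nonadjacent(2)[OF assms(2) X(1) that(1-4) _ that(5)] cW
    by (simp add: W_def)
  then have "G = hat_graph H W (parcs G \<inter> W \<times> W) (parcs G \<inter> W \<times> universal_verts H)"
    unfolding H_def W_def by (rule hat_graph_induced[OF assms(2) XV])
  moreover have "parcs G \<inter> W \<times> universal_verts H \<subseteq> W \<times> universal_verts H"
    by blast
  moreover have "pair_graph H"
    unfolding H_def by (rule pair_graph_induced[OF assms(2) XV])
  moreover have "card (pverts H) = card (pverts G) - k - 1"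
    using X assms(4) by (simp add: H_def)
  moreover have "finite W" "W \<inter> pverts H = {}"
    using pair_finite_verts by (auto simp: W_def H_def)
  moreover have "sym (parcs G \<inter> W \<times> W)" "irrefl (parcs G \<inter> W \<times> W)"
    using arcs_symmetric no_loops' by (auto intro!: symI simp: irrefl_def)
  moreover have "parcs G \<inter> W \<times> W \<subseteq> W \<times> W"
    by blast
  moreover have "clique_number G \<le> card (pverts G) - k - 1"
    using clique_number_le_ftmv_number[OF assms(2), of k] assms(4) by simp
  moreover have "k + 2 \<le> card (pverts G)"
    using pos assms(4) by simp
  ultimately show ?thesis
    unfolding H_family_def using assms(1,3) cW by blast
qed

section \<open>From hat graphs to the extremal value\<close>

lemma ftmv_set_hat_graph:
  assumes "pair_graph G" "pair_graph H" "card W = k + 1" "W \<inter> pverts H = {}"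
    and G: "G = hat_graph H W EW EA"
  shows "ftmv_set k G (pverts H)"
  unfolding ftmv_set_def
proof (intro conjI ballI impI)
  interpret H: pair_graph H by fact
  show "pverts H \<subseteq> pverts G"
    by (auto simp: G hat_graph_def Let_def)
  fix u v assume uv: "u \<in> pverts H" "v \<in> pverts H" "u \<noteq> v \<and> (u, v) \<notin> parcs G"
  then have "(u, v) \<notin> parcs H" "(v, u) \<notin> parcs H"
    using H.arcs_symmetric by (auto simp: G hat_graph_def Let_def)
  \<comment> \<open>Each of \<open>u\<close> and \<open>v\<close> witnesses that the other is not
    universal, so the construction joins both to every vertex of \<open>W\<close>.\<close>
  then have "u \<notin> universal_verts H" "v \<notin> universal_verts H"
    using uv by (auto simp: universal_verts_def)
  then have arcs: "(u, w) \<in> parcs G" "(w, v) \<in> parcs G" if "w \<in> W" for w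
    using that uv by (auto simp: G hat_graph_def Let_def)
  let ?P = "(\<lambda>w. [u, w, v]) ` W"
  have "card ?P = k + 1"
    using assms(3) by (subst card_image) (auto intro: inj_onI)
  moreover have "shortest_path G u p v \<and> set p \<inter> pverts H = {u, v}" if "p \<in> ?P" for p
    using that uv arcs assms(4) shortest_path_common_neighbour[OF assms(1)] by auto
  moreover have "pairwise (internally_disjoint u v) ?P"
    by (auto simp: pairwise_def internally_disjoint_def)
  ultimately show "\<exists>P. card P = k + 1 \<and>
      (\<forall>p\<in>P. shortest_path G u p v \<and> set p \<inter> pverts H = {u, v}) \<and>
      pairwise (internally_disjoint u v) P"
    by blast
qed

lemma ftmv_number_H_family:
  assumes "pair_graph G" "G \<in> H_family (card (pverts G)) k"
  shows "ftmv_number k G + k + 1 = card (pverts G)"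
proof -
  let ?n = "card (pverts G)"
  obtain H W EW EA where H: "pair_graph H" "card (pverts H) = ?n - k - 1"
      "card W = k + 1" "W \<inter> pverts H = {}" "G = hat_graph H W EW EA"
    and n: "k + 2 \<le> ?n" and cl: "clique_number G \<le> ?n - k - 1"
    using assms(2) unfolding H_family_def by blast
  have "?n - k - 1 \<le> ftmv_number k G"
    using ftmv_number_ge[OF assms(1) ftmv_set_hat_graph[OF assms(1) H(1,3,4,5)]] H(2) by simp
  moreover obtain X where X: "ftmv_set k G X" "card X = ftmv_number k G"
    using ftmv_number_attained[OF assms(1)] .
  \<comment> \<open>If \<open>X\<close> is a clique, the clique number bounds it; otherwise it
    misses at least \<open>k + 1\<close> vertices.\<close>
  have "card X \<le> ?n - k - 1"
    using card_ftmv_set_le[OF assms(1) X(1)] clique_number_ge[OF assms(1), of X] cl by auto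
  ultimately show ?thesis
    using n X(2) by linarith
qed

theorem theorem5p4:
  fixes G :: "'a pair_pre_digraph" and k :: nat
  assumes "k \<ge> 1"
    and "pair_graph G"
    and "Digraph_Component.connected (with_proj G)"
  shows "int (ftmv_number k G) = int (card (pverts G)) - int k - 1
    \<longleftrightarrow> G \<in> H_family (card (pverts G)) k"
proof -
  \<comment> \<open>The additive form over the naturals avoids truncated subtraction.\<close>
  have "int (ftmv_number k G) = int (card (pverts G)) - int k - 1
      \<longleftrightarrow> ftmv_number k G + k + 1 = card (pverts G)"
    by linarith
  then show ?thesis
    using H_familyI[OF assms] ftmv_number_H_family[OF assms(2)] by blast
qed

end
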